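(* Let $k\geq 2$ be an integer, and for $0\leq i<k$ let $\mathbf{a}_i=\{a_i(n)\}_{n\geq 0}$ and $\mathbf{b}_i=\{b_i(n)\}_{n\geq 0}$ be integer sequences such that each $\mathbf{a}_i$ is $k$-automatic and each $\mathbf{b}_i$ is $k$-regular. Let $\mathbf{u}=\{u(n)\}_{n\geq 0}$ be an integer sequence for which there exist an integer $N\geq 0$ and integers $j_i\geq 0$ $(0\leq i<k)$ such that $$u(kn+i)=a_i(n)\,u(n+j_i)+b_i(n)\qquad (0\leq i<k,\ n\geq N).$$ (That is, $\mathbf{u}$ is a polynomial generated sequence with shift, with polynomials $f_i(x)=\mathbf{a}_i x+\mathbf{b}_i$ and shifts $S_i=S^{j_i}$.) Then $\mathbf{u}$ is $k$-regular.
   Context: The $k$-kernel of a sequence $\mathbf{u}=\{u(n)\}_{n\geq 0}$ is the set of subsequences $\mathcal{K}_k(\mathbf{u})=\{\{u(k^i n+j)\}_{n\geq 0}: i\geq 0,\ 0\leq j<k^i\}$. A sequence taking values in a finite set is $k$-automatic if its $k$-kernel is a finite set. An integer sequence $\{u(n)\}_{n\geq 0}$ is $k$-regular (over $\mathbb{Z}$) if there exist finitely many integer sequences $\{a_1(n)\}_{n\geq 0},\dots,\{a_M(n)\}_{n\geq 0}$ such that every element of its $k$-kernel is a $\mathbb{Z}$-linear combination of them. The shift map is $S(\{u(n)\}_{n\geq 0})=\{u(n+1)\}_{n\geq 0}$, and $S^j$ is its $j$-th iterate. *)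

theory Defs
  imports Main
begin

definition k_kernel :: "nat \<Rightarrow> (nat \<Rightarrow> 'a) \<Rightarrow> (nat \<Rightarrow> 'a) set" where
  "k_kernel k u = {(\<lambda>n. u (k ^ i * n + j)) | i j. j < k ^ i}"

definition k_automatic :: "nat \<Rightarrow> (nat \<Rightarrow> 'a) \<Rightarrow> bool" where
  "k_automatic k u \<longleftrightarrow> finite (range u) \<and> finite (k_kernel k u)"

text \<open>
  Regularity over the integers. The finitely many sequences \<open>g 0, \<dots>, g (M - 1)\<close> are
  arbitrary integer sequences; they need not belong to the kernel of \<open>u\<close>.
\<close>

definition k_regular :: "nat \<Rightarrow> (nat \<Rightarrow> int) \<Rightarrow> bool" where
  "k_regular k u \<longleftrightarrow>
     (\<exists>(M::nat) (g :: nat \<Rightarrow> nat \<Rightarrow> int).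
        \<forall>v \<in> k_kernel k u. \<exists>c :: nat \<Rightarrow> int. v = (\<lambda>n. \<Sum>m<M. c m * g m n))"

end

theory Submission
  imports Defs "HOL-Library.FuncSet"
begin

text \<open>
  Write \<open>T\<^sub>r v = (\<lambda>n. v (k * n + r))\<close>. The values of \<open>a\<^sub>i (n + q)\<close>, for \<open>q\<close> in a fixed range, are
  read off the state of a finite automaton at \<open>n\<close>; the integer functions of that state
  form a ring \<open>G\<close> that is finitely generated as a group and stable under every \<open>T\<^sub>r\<close>.
  The sequences \<open>g(n) u(n + s)\<close> and \<open>g(n) v(n + s)\<close>, where \<open>g \<in> G\<close>, \<open>v\<close> lies in the kernel of
  some \<open>b\<^sub>i\<close> and \<open>s \<le> Q\<close>, together with the sequences vanishing from \<open>N\<close> on, generate a group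
  stable under every \<open>T\<^sub>r\<close>: dividing by \<open>k \<ge> 2\<close> halves a shift before the recurrence adds \<open>j\<^sub>i\<close>,
  so shifts stay below \<open>Q = 2 max j\<^sub>i + 1\<close>. This group contains the kernel of \<open>u\<close>,
  and it is contained in a finitely generated one.
\<close>

section \<open>Integer combinations of sequences\<close>

text \<open>The subgroup generated by \<open>B\<close>, built one multiple at a time so that rule
  induction gives its closure properties; \<open>B\<close> may be infinite.\<close>

inductive_set zspan :: "(nat \<Rightarrow> int) set \<Rightarrow> (nat \<Rightarrow> int) set" for B where
  zero: "(\<lambda>_. 0) \<in> zspan B"
| step: "v \<in> zspan B \<Longrightarrow> b \<in> B \<Longrightarrow> (\<lambda>n. v n + c * b n) \<in> zspan B"

lemma zspan_add: "v \<in> zspan B \<Longrightarrow> w \<in> zspan B \<Longrightarrow> (\<lambda>n. v n + w n) \<in> zspan B"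
proof (induction rule: zspan.induct)
  case (step v b c)
  then show ?case
    using zspan.step[of "\<lambda>n. v n + w n" B b c] by (simp add: algebra_simps)
qed simp

lemma zspan_scale: "v \<in> zspan B \<Longrightarrow> (\<lambda>n. c * v n) \<in> zspan B"
proof (induction rule: zspan.induct)
  case (step v b d)
  then show ?case
    using zspan.step[of "\<lambda>n. c * v n" B b "c * d"] by (simp add: algebra_simps)
qed (simp add: zspan.zero)

lemma zspan_base: "b \<in> B \<Longrightarrow> b \<in> zspan B"
  using zspan.step[OF zspan.zero, of b B 1] by simp

lemma zspan_sum:
  "finite I \<Longrightarrow> (\<And>i. i \<in> I \<Longrightarrow> f i \<in> zspan B) \<Longrightarrow> (\<lambda>n. \<Sum>i\<in>I. f i n) \<in> zspan B"
  by (induction rule: finite_induct) (auto intro: zspan_add zspan.zero)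

text \<open>Composition with \<open>p\<close> is additive, so generators suffice. The main uses are
  \<open>p n = k * n + r\<close>, for stability under sections, and \<open>p n = n + s\<close>, for
  shifts.\<close>

lemma zspan_subst:
  "v \<in> zspan B \<Longrightarrow> (\<And>b. b \<in> B \<Longrightarrow> (\<lambda>n. b (p n)) \<in> zspan C) \<Longrightarrow> (\<lambda>n. v (p n)) \<in> zspan C"
proof (induction rule: zspan.induct)
  case (step v b c)
  then show ?case by (intro zspan_add zspan_scale) auto
qed (simp add: zspan.zero)

lemma zspan_trans: "v \<in> zspan B \<Longrightarrow> B \<subseteq> zspan C \<Longrightarrow> v \<in> zspan C"
  using zspan_subst[of v B "\<lambda>n. n" C] by auto

lemma zspan_mono: "v \<in> zspan B \<Longrightarrow> B \<subseteq> C \<Longrightarrow> v \<in> zspan C"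
  using zspan_base by (blast intro: zspan_trans)

text \<open>The pointwise product is bilinear: one induction for each factor reduces to products of
  generators.\<close>

lemma zspan_mult:
  assumes "v \<in> zspan B" "w \<in> zspan C" "\<And>b c. b \<in> B \<Longrightarrow> c \<in> C \<Longrightarrow> (\<lambda>n. b n * c n) \<in> zspan D"
  shows "(\<lambda>n. v n * w n) \<in> zspan D"
  using assms(1)
proof (induction rule: zspan.induct)
  case (step v b d)
  have "(\<lambda>n. b n * w n) \<in> zspan D"
    using assms(2)
  proof (induction rule: zspan.induct)
    case (step w c e)
    then have "(\<lambda>n. b n * w n + e * (b n * c n)) \<in> zspan D"
      using assms(3) \<open>b \<in> B\<close> by (intro zspan_add zspan_scale) auto
    then show ?case by (simp add: algebra_simps)
  qed (simp add: zspan.zero)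
  then have "(\<lambda>n. v n * w n + d * (b n * w n)) \<in> zspan D"
    using step by (intro zspan_add zspan_scale) auto
  then show ?case by (simp add: algebra_simps)
qed (simp add: zspan.zero)

lemma zspan_explicit:
  fixes g :: "nat \<Rightarrow> nat \<Rightarrow> int"
  shows "v \<in> zspan (g ` {..<M}) \<Longrightarrow> \<exists>c. v = (\<lambda>n. \<Sum>m<M. c m * g m n)"
proof (induction rule: zspan.induct)
  case zero
  show ?case by (rule exI[of _ "\<lambda>_. 0"]) simp
next
  case (step v b d)
  then obtain c l where c: "v = (\<lambda>n. \<Sum>m<M. c m * g m n)" and l: "l < M" "b = g l"
    by auto
  have "(\<Sum>m<M. c m * g m n) + d * g l n = (\<Sum>m<M. (c m + (if m = l then d else 0)) * g m n)" for n
  proof -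
    have "(\<Sum>m<M. (if m = l then d else 0) * g m n) = (\<Sum>m<M. if m = l then d * g m n else 0)"
      by (intro sum.cong) auto
    with l show ?thesis by (simp add: distrib_right sum.distrib)
  qed
  with c l(2) show ?case
    by (intro exI[of _ "\<lambda>m. c m + (if m = l then d else 0)"]) simp
qed

lemma k_regular_iff_zspan: "k_regular k u \<longleftrightarrow> (\<exists>B. finite B \<and> k_kernel k u \<subseteq> zspan B)"
proof
  assume "k_regular k u"
  then obtain M and g :: "nat \<Rightarrow> nat \<Rightarrow> int"
    where *: "\<forall>v\<in>k_kernel k u. \<exists>c. v = (\<lambda>n. \<Sum>m<M. c m * g m n)"
    unfolding k_regular_def by blast
  have "k_kernel k u \<subseteq> zspan (g ` {..<M})"
  proof
    fix v assume "v \<in> k_kernel k u"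
    with * obtain c where "v = (\<lambda>n. \<Sum>m<M. c m * g m n)" by blast
    moreover have "\<dots> \<in> zspan (g ` {..<M})"
      by (intro zspan_sum zspan_scale zspan_base) auto
    ultimately show "v \<in> zspan (g ` {..<M})" by simp
  qed
  then show "\<exists>B. finite B \<and> k_kernel k u \<subseteq> zspan B" by blast
next
  assume "\<exists>B. finite B \<and> k_kernel k u \<subseteq> zspan B"
  then obtain B where B: "finite B" "k_kernel k u \<subseteq> zspan B" by blast
  obtain g :: "nat \<Rightarrow> nat \<Rightarrow> int" and M where "B = g ` {i. i < M}"
    using finite_imp_nat_seg_image_inj_on[OF B(1)] by blast
  then show "k_regular k u"
    using B(2) zspan_explicit[of _ g M] unfolding k_regular_def lessThan_def by blast
qed

section \<open>Kernels\<close>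

lemma k_kernel_self: "u \<in> k_kernel k u"
  unfolding k_kernel_def by (force intro: exI[of _ 0])

lemma k_kernel_section:
  assumes "v \<in> k_kernel k u" "r < k"
  shows "(\<lambda>n. v (k * n + r)) \<in> k_kernel k u"
proof -
  from assms(1) obtain i l where v: "v = (\<lambda>n. u (k ^ i * n + l))" and l: "l < k ^ i"
    unfolding k_kernel_def by blast
  have "k ^ i * r + l < k ^ i * Suc r" using l by simp
  also have "\<dots> \<le> k ^ i * k" using assms(2) by (intro mult_le_mono) auto
  finally have "k ^ i * r + l < k ^ Suc i" by (simp add: mult.commute)
  moreover have "(\<lambda>n. v (k * n + r)) = (\<lambda>n. u (k ^ Suc i * n + (k ^ i * r + l)))"
    unfolding v by (simp add: algebra_simps)
  ultimately show ?thesis unfolding k_kernel_def by blast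
qed

text \<open>Every kernel element arises from \<open>u\<close> by iterated sections, one for each of
  the \<open>i\<close> base-\<open>k\<close> digits of its offset.\<close>

lemma k_kernel_subset:
  assumes "k > 0" "u \<in> A" "\<And>v r. v \<in> A \<Longrightarrow> r < k \<Longrightarrow> (\<lambda>n. v (k * n + r)) \<in> A"
  shows "k_kernel k u \<subseteq> A"
proof -
  have "(\<lambda>n. u (k ^ i * n + l)) \<in> A" if "l < k ^ i" for i l
    using that
  proof (induction i arbitrary: l)
    case 0
    with assms(2) show ?case by simp
  next
    case (Suc i)
    \<comment> \<open>\<open>?r\<close> is the leading base-\<open>k\<close> digit of
      \<open>l\<close> and \<open>?l\<close> the rest: the sequence of the induction hypothesis for
      \<open>?l\<close>, cut by the section \<open>?r\<close>, is the one for
      \<open>l\<close>.\<close>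
    let ?r = "l div k ^ i" and ?l = "l mod k ^ i"
    have "?l < k ^ i" using assms(1) by simp
    moreover have "?r < k" using Suc.prems by (simp add: less_mult_imp_div_less)
    ultimately have "(\<lambda>n. u (k ^ i * (k * n + ?r) + ?l)) \<in> A"
      using assms(3)[OF Suc.IH] by blast
    moreover have "k ^ i * (k * n + ?r) + ?l = k ^ Suc i * n + l" for n
    proof -
      have "k ^ i * (k * n + ?r) + ?l = k ^ Suc i * n + (k ^ i * ?r + ?l)"
        by (simp add: algebra_simps)
      then show ?thesis by simp
    qed
    ultimately show ?case by simp
  qed
  then show ?thesis unfolding k_kernel_def by blast
qed

lemma k_kernel_finite_range:
  "finite (range u) \<Longrightarrow> v \<in> k_kernel k u \<Longrightarrow> finite (range v)"
  unfolding k_kernel_def by (auto elim: rev_finite_subset)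

section \<open>The ring of functions of the automaton state\<close>

text \<open>The state of the automaton at \<open>n\<close> is the tuple of the values \<open>f n\<close>, \<open>f \<in> F\<close>.\<close>

definition factoring :: "(nat \<Rightarrow> int) set \<Rightarrow> (nat \<Rightarrow> int) set" where
  "factoring F = {g. \<forall>m n. (\<forall>f\<in>F. f m = f n) \<longrightarrow> g m = g n}"

lemma factoring_base: "f \<in> F \<Longrightarrow> f \<in> factoring F"
  unfolding factoring_def by blast

lemma factoring_const: "(\<lambda>_. c) \<in> factoring F"
  unfolding factoring_def by blast

lemma factoring_mult: "g \<in> factoring F \<Longrightarrow> h \<in> factoring F \<Longrightarrow> (\<lambda>n. g n * h n) \<in> factoring F"
  unfolding factoring_def mem_Collect_eq by metis

text \<open>The hypothesis on \<open>F\<close> makes the state at \<open>n\<close> determine the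
  state at \<open>p n\<close>: this is the transition map of the automaton.\<close>

lemma factoring_subst:
  assumes "g \<in> factoring F" "\<And>f. f \<in> F \<Longrightarrow> (\<lambda>n. f (p n)) \<in> F"
  shows "(\<lambda>n. g (p n)) \<in> factoring F"
  unfolding factoring_def
proof (intro CollectI allI impI)
  fix m n
  assume eq: "\<forall>f\<in>F. f m = f n"
  have "f (p m) = f (p n)" if "f \<in> F" for f
    using bspec[OF eq assms(2)[OF that]] by simp
  with assms(1) show "g (p m) = g (p n)" unfolding factoring_def by blast
qed

text \<open>There are only finitely many states, and a function of the state is an integer
  combination of their indicators.\<close>

lemma factoring_finitely_spanned:
  assumes "finite F" "\<And>f. f \<in> F \<Longrightarrow> finite (range f)"
  obtains E where "finite E" "factoring F \<subseteq> zspan E"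
proof
  \<comment> \<open>Restricting to \<open>F\<close> puts every state into a finite product of finite
    ranges.\<close>
  define state where "state n = restrict (\<lambda>f. f n) F" for n :: nat
  define E where "E = (\<lambda>x n. of_bool (state n = x) :: int) ` range state"
  have "range state \<subseteq> (\<Pi>\<^sub>E f\<in>F. range f)" by (auto simp: state_def)
  then have fin: "finite (range state)"
    using assms by (meson finite_PiE finite_subset)
  then show "finite E" by (simp add: E_def)
  show "factoring F \<subseteq> zspan E"
  proof
    fix g assume g: "g \<in> factoring F"
    have eq: "g m = g n" if "state m = state n" for m n
    proof -
      have "f m = f n" if "f \<in> F" for f
        using fun_cong[OF \<open>state m = state n\<close>, of f] that by (simp add: state_def)
      with g show ?thesis unfolding factoring_def by blast
    qed
    \<comment> \<open>\<open>inv state x\<close> picks some position with state \<open>x\<close>; by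
      \<open>eq\<close> the choice does not affect the value of \<open>g\<close>.\<close>
    have "g n = (\<Sum>x\<in>range state. g (inv state x) * of_bool (state n = x))" for n
    proof -
      have "(\<Sum>x\<in>range state. g (inv state x) * of_bool (state n = x))
          = (\<Sum>x\<in>range state. if state n = x then g (inv state x) else 0)"
        by (intro sum.cong) auto
      also have "\<dots> = g (inv state (state n))" using fin by simp
      also have "\<dots> = g n" by (intro eq) (simp add: f_inv_into_f)
      finally show ?thesis by simp
    qed
    then have "g = (\<lambda>n. \<Sum>x\<in>range state. g (inv state x) * of_bool (state n = x))" by blast
    moreover have "\<dots> \<in> zspan E"
      using fin by (intro zspan_sum zspan_scale zspan_base) (auto simp: E_def)
    ultimately show "g \<in> zspan E" by simp
  qed
qed

text \<open>Since \<open>2 * J \<le> k * J\<close>, the sum \<open>r + s\<close> is below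
  \<open>(J + 2) * k\<close>. A further shift of at most \<open>J\<close> then leads back to at most
  \<open>2 * J + 1\<close>.\<close>

lemma shift_div_le:
  fixes k :: nat
  assumes "k \<ge> 2" "r < k" "s \<le> 2 * J + 1"
  shows "(r + s) div k \<le> J + 1"
proof -
  have "2 * J \<le> k * J" using assms(1) by simp
  moreover have "(J + 2) * k = k * J + k + k" by (simp add: algebra_simps)
  ultimately have "r + s < (J + 2) * k" using assms by linarith
  then have "(r + s) div k < J + 2" by (rule less_mult_imp_div_less)
  then show ?thesis by simp
qed

lemma automatic_ring:
  fixes a :: "nat \<Rightarrow> nat \<Rightarrow> int"
  assumes "k \<ge> 2" "\<And>i. i < k \<Longrightarrow> k_automatic k (a i)"
  obtains E G where
    "finite E" "G \<subseteq> zspan E" "\<And>c. (\<lambda>_. c) \<in> G"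
    "\<And>g h. g \<in> G \<Longrightarrow> h \<in> G \<Longrightarrow> (\<lambda>n. g n * h n) \<in> G"
    "\<And>g r. g \<in> G \<Longrightarrow> r < k \<Longrightarrow> (\<lambda>n. g (k * n + r)) \<in> G"
    "\<And>i q. i < k \<Longrightarrow> q \<le> J + 1 \<Longrightarrow> (\<lambda>n. a i (n + q)) \<in> G"
proof -
  \<comment> \<open>Shifts up to \<open>2 * J + 1\<close> form a range that
    \<open>shift_div_le\<close> keeps closed under sections.\<close>
  define F where "F = (\<lambda>(q, v) n. v (n + q)) ` ({..2 * J + 1} \<times> (\<Union>i<k. k_kernel k (a i)))"
  have finF: "finite F" using assms(2) by (auto simp: F_def k_automatic_def)
  have rangeF: "finite (range f)" if "f \<in> F" for f
  proof -
    obtain q v i where f: "f = (\<lambda>n. v (n + q))" "q \<le> 2 * J + 1"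
      and v: "v \<in> k_kernel k (a i)" "i < k"
      using \<open>f \<in> F\<close> by (auto simp: F_def)
    have "finite (range v)"
      using v assms(2) by (auto simp: k_automatic_def intro: k_kernel_finite_range)
    then show ?thesis unfolding f(1) by (rule rev_finite_subset) auto
  qed
  have shiftF: "(\<lambda>n. f (k * n + r)) \<in> F" if "f \<in> F" "r < k" for f r
  proof -
    obtain q v i where f: "f = (\<lambda>n. v (n + q))" "q \<le> 2 * J + 1"
      and v: "v \<in> k_kernel k (a i)" "i < k"
      using \<open>f \<in> F\<close> by (auto simp: F_def)
    \<comment> \<open>A section of a shifted sequence is a shifted section: the remainder selects
      the section and the quotient is the new shift.\<close>
    let ?q = "(r + q) div k" and ?r = "(r + q) mod k"
    have "k * n + r + q = k * (n + ?q) + ?r" for n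
      by (simp add: algebra_simps)
    then have "(\<lambda>n. f (k * n + r)) = (\<lambda>n. v (k * (n + ?q) + ?r))"
      by (simp add: f)
    moreover have "(\<lambda>n. v (k * n + ?r)) \<in> k_kernel k (a i)"
      using v assms(1) by (intro k_kernel_section) auto
    moreover have "?q \<le> 2 * J + 1"
      using shift_div_le[OF assms(1) that(2) f(2)] by simp
    ultimately show ?thesis
      using v(2) unfolding F_def by (intro image_eqI[of _ _ "(?q, \<lambda>n. v (k * n + ?r))"]) auto
  qed
  obtain E where E: "finite E" "factoring F \<subseteq> zspan E"
    using factoring_finitely_spanned[OF finF rangeF] by blast
  show thesis
  proof (rule that[OF E factoring_const factoring_mult])
    show "(\<lambda>n. g (k * n + r)) \<in> factoring F" if "g \<in> factoring F" "r < k" for g r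
      using factoring_subst[OF that(1) shiftF[OF _ that(2)]] .
    show "(\<lambda>n. a i (n + q)) \<in> factoring F" if "i < k" "q \<le> J + 1" for i q
      using that k_kernel_self
      by (intro factoring_base) (force simp: F_def intro: image_eqI[of _ _ "(q, a i)"])
  qed
qed

section \<open>The stable group of sequences and the regularity of \<open>u\<close>\<close>

lemma eventually_zero_zspan:
  assumes "\<And>n. n \<ge> N \<Longrightarrow> d n = 0"
  shows "d \<in> zspan ((\<lambda>m n. of_bool (n = m)) ` {..<N})"
proof -
  have "d n = (\<Sum>m<N. d m * of_bool (n = m))" for n
  proof -
    have "(\<Sum>m<N. d m * of_bool (n = m)) = (\<Sum>m<N. if n = m then d m else 0)"
      by (intro sum.cong) auto
    also have "\<dots> = d n" using assms by simp
    finally show ?thesis by simp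
  qed
  then have "d = (\<lambda>n. \<Sum>m<N. d m * of_bool (n = m))" by blast
  moreover have "\<dots> \<in> zspan ((\<lambda>m n. of_bool (n = m)) ` {..<N})"
    by (intro zspan_sum zspan_scale zspan_base) auto
  ultimately show ?thesis by simp
qed

theorem theorem2:
  fixes k N :: nat
    and a b :: "nat \<Rightarrow> nat \<Rightarrow> int"
    and j :: "nat \<Rightarrow> nat"
    and u :: "nat \<Rightarrow> int"
  assumes "k \<ge> 2"
    and "\<And>i. i < k \<Longrightarrow> k_automatic k (a i)"
    and "\<And>i. i < k \<Longrightarrow> k_regular k (b i)"
    and "\<And>i n. i < k \<Longrightarrow> n \<ge> N \<Longrightarrow> u (k * n + i) = a i n * u (n + j i) + b i n"
  shows "k_regular k u"
proof -
  define J where "J = Max (j ` {..<k})"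
  define Q where "Q = 2 * J + 1"
  have jJ: "j i \<le> J" if "i < k" for i
    unfolding J_def using that by (intro Max_ge) auto
  obtain E G where finE: "finite E" and GE: "G \<subseteq> zspan E" and G_const: "\<And>c. (\<lambda>_. c) \<in> G"
    and G_mult: "\<And>g h. g \<in> G \<Longrightarrow> h \<in> G \<Longrightarrow> (\<lambda>n. g n * h n) \<in> G"
    and G_sect: "\<And>g r. g \<in> G \<Longrightarrow> r < k \<Longrightarrow> (\<lambda>n. g (k * n + r)) \<in> G"
    and G_a: "\<And>i q. i < k \<Longrightarrow> q \<le> J + 1 \<Longrightarrow> (\<lambda>n. a i (n + q)) \<in> G"
    by (rule automatic_ring[where k = k and a = a and J = J])
      (assumption | rule assms(1,2) that)+
  have "\<forall>i\<in>{..<k}. \<exists>B. finite B \<and> k_kernel k (b i) \<subseteq> zspan B"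
    using assms(3) by (simp add: k_regular_iff_zspan)
  then obtain W where W: "\<And>i. i < k \<Longrightarrow> finite (W i)" "\<And>i. i < k \<Longrightarrow> k_kernel k (b i) \<subseteq> zspan (W i)"
    by (metis lessThan_iff)
  define V where "V = (\<Union>i<k. k_kernel k (b i))"
  \<comment> \<open>\<open>V\<close> and \<open>M\<close> may be infinite: \<open>M\<close>
    generates the stable group, while \<open>U\<close> and \<open>B\<close> supply finitely many
    generators of a group containing it. \<open>D\<close> absorbs the indices below
    \<open>N\<close>, where the recurrence may fail.\<close>
  define U where "U = insert u (\<Union>i<k. W i)"
  define D where "D = {d :: nat \<Rightarrow> int. \<forall>n\<ge>N. d n = 0}"
  define M where "M = {(\<lambda>n. g n * v (n + q)) | g v q. g \<in> G \<and> v \<in> insert u V \<and> q \<le> Q} \<union> D"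
  define B where "B = (\<lambda>(e, w, q) n. e n * w (n + q)) ` (E \<times> U \<times> {..Q})
    \<union> (\<lambda>m n. of_bool (n = m)) ` {..<N}"
  have M_I: "(\<lambda>n. g n * v (n + q)) \<in> M" if "g \<in> G" "v \<in> insert u V" "q \<le> Q" for g v q
    unfolding M_def using that by blast
  have V_sect: "(\<lambda>n. v (k * n + r)) \<in> V" if "v \<in> V" "r < k" for v r
    using that k_kernel_section unfolding V_def by blast
  have M_sect: "(\<lambda>n. v (k * n + r)) \<in> zspan M" if "v \<in> M" and r: "r < k" for v r
  proof -
    consider "v \<in> D" | g w s where "v = (\<lambda>n. g n * w (n + s))" "g \<in> G" "w \<in> insert u V" "s \<le> Q"
      using \<open>v \<in> M\<close> unfolding M_def by blast
    then show ?thesis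
    proof cases
      case 1
      \<comment> \<open>Indices do not decrease under a section, so vanishing from \<open>N\<close>
        on is preserved.\<close>
      have "n \<le> k * n + r" for n
        using assms(1) by (simp add: trans_le_add1)
      then have "(\<lambda>n. v (k * n + r)) \<in> D"
        using 1 unfolding D_def mem_Collect_eq by (meson le_trans)
      then show ?thesis by (auto simp: M_def intro: zspan_base)
    next
      case 2
      define q i where "q = (r + s) div k" and "i = (r + s) mod k"
      have i: "i < k" using assms(1) by (simp add: i_def)
      have q: "q \<le> J + 1"
        unfolding q_def using 2(4) by (intro shift_div_le assms(1) r) (simp add: Q_def)
      have "k * n + r + s = k * (n + q) + i" for n
        by (simp add: q_def i_def algebra_simps)
      then have v: "(\<lambda>n. v (k * n + r)) = (\<lambda>n. g (k * n + r) * w (k * (n + q) + i))"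
        by (simp add: 2(1))
      have g: "(\<lambda>n. g (k * n + r)) \<in> G" using G_sect 2(2) r .
      have qQ: "q \<le> Q" using q by (simp add: Q_def)
      show ?thesis
      proof (cases "w \<in> V")
        case True
        then have "(\<lambda>n. g (k * n + r) * w (k * (n + q) + i)) \<in> M"
          using M_I[OF g, of "\<lambda>n. w (k * n + i)" q] V_sect i qQ by blast
        then show ?thesis unfolding v by (rule zspan_base)
      next
        case False
        then have w: "w = u" using 2(3) by blast
        \<comment> \<open>The recurrence at \<open>n + q\<close> splits the section into
          \<open>x\<close>, whose shift \<open>q + j i\<close> is at most
          \<open>(J + 1) + J = Q\<close>, and \<open>y\<close>, an element of \<open>G\<close> times
          a shift of \<open>b i\<close>. The error \<open>d\<close> can be nonzero only below
          \<open>N\<close>.\<close>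
        define x where "x n = (g (k * n + r) * a i (n + q)) * u (n + (q + j i))" for n
        define y where "y n = g (k * n + r) * b i (n + q)" for n
        define d where "d n = v (k * n + r) - (x n + y n)" for n
        have "x \<in> M"
          unfolding x_def using jJ[OF i] q
          by (intro M_I G_mult[OF g] G_a i) (auto simp: Q_def)
        moreover have "b i \<in> V" using i k_kernel_self unfolding V_def by blast
        then have "y \<in> M"
          unfolding y_def using M_I[OF g] qQ by blast
        moreover have "d n = 0" if "n \<ge> N" for n
        proof -
          have "v (k * n + r) = g (k * n + r) * u (k * (n + q) + i)"
            using fun_cong[OF v, of n] w by simp
          then show ?thesis
            using that assms(4)[OF i, of "n + q"]
            by (simp add: d_def x_def y_def algebra_simps)
        qed
        then have "d \<in> M" by (simp add: M_def D_def)
        ultimately have "(\<lambda>n. (x n + y n) + d n) \<in> zspan M"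
          by (intro zspan_add zspan_base)
        then show ?thesis by (simp add: d_def)
      qed
    qed
  qed
  have "u \<in> zspan M"
    \<comment> \<open>\<open>u\<close> is the generator with factor 1 and shift 0.\<close>
    using zspan_base[OF M_I[OF G_const[of 1], of u 0]] by simp
  then have "k_kernel k u \<subseteq> zspan M"
    using assms(1) M_sect by (intro k_kernel_subset) (auto intro: zspan_subst)
  moreover have "M \<subseteq> zspan B"
  proof
    fix v assume "v \<in> M"
    then consider "v \<in> D" | g w s where "v = (\<lambda>n. g n * w (n + s))" "g \<in> G" "w \<in> insert u V" "s \<le> Q"
      unfolding M_def by blast
    then show "v \<in> zspan B"
    proof cases
      case 1
      then have "v \<in> zspan ((\<lambda>m n. of_bool (n = m)) ` {..<N})"
        by (intro eventually_zero_zspan) (simp add: D_def)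
      then show ?thesis by (rule zspan_mono) (simp add: B_def)
    next
      case 2
      \<comment> \<open>Expanding \<open>w\<close> over \<open>U\<close> and \<open>g\<close> over
        \<open>E\<close>, bilinearity writes their shifted product over the finite set
        \<open>B\<close>.\<close>
      have "w \<in> zspan U"
      proof (cases "w = u")
        case True
        then show ?thesis by (simp add: U_def zspan_base)
      next
        case False
        then obtain i where i: "i < k" "w \<in> k_kernel k (b i)"
          using 2(3) by (auto simp: V_def)
        then have "w \<in> zspan (W i)" using W(2) by blast
        then show ?thesis by (rule zspan_mono) (use i(1) in \<open>auto simp: U_def\<close>)
      qed
      then have "(\<lambda>n. w (n + s)) \<in> zspan ((\<lambda>w n. w (n + s)) ` U)"
        by (rule zspan_subst) (auto intro: zspan_base)
      moreover have "(\<lambda>n. e n * x n) \<in> zspan B"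
        if "e \<in> E" "x \<in> (\<lambda>w n. w (n + s)) ` U" for e x
      proof -
        obtain w' where "w' \<in> U" "x = (\<lambda>n. w' (n + s))" using \<open>x \<in> _\<close> by blast
        then have "(\<lambda>n. e n * x n) \<in> B"
          using \<open>e \<in> E\<close> 2(4) unfolding B_def by (intro UnI1 image_eqI[of _ _ "(e, w', s)"]) auto
        then show ?thesis by (rule zspan_base)
      qed
      ultimately show ?thesis
        unfolding 2(1) using GE 2(2) zspan_mult[of g E "\<lambda>n. w (n + s)"] by blast
    qed
  qed
  ultimately have "k_kernel k u \<subseteq> zspan B" by (blast intro: zspan_trans)
  moreover have "finite B" using finE W(1) by (simp add: B_def U_def)
  ultimately show ?thesis unfolding k_regular_iff_zspan by blast
qed

end
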